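(* Let $W$ be a Coxeter group of finite rank. Let $w\in W$ be an involution such that $\mathrm{FC}(w)=\langle w\rangle$, and let $S\subseteq W$ be such that $(W,S)$ is a Coxeter system. Then $w\in S^W$.
   Context: For $w\in W$ of finite order, the finite continuation $\mathrm{FC}(w)$ is the intersection of all maximal finite subgroups of $W$ containing $w$. $S^W=\{x^{-1}sx\mid s\in S,\ x\in W\}$ is the set of all $W$-conjugates of elements of $S$. *)

theory Defs
  imports "HOL-Algebra.Algebra"
begin

text \<open>
  Words over \<open>S\<close> are lists of letters \<open>(s, b)\<close> with \<open>s \<in> S\<close>, where \<open>(s, True)\<close> stands for the
  generator \<open>s\<close> and \<open>(s, False)\<close> for its formal inverse.
\<close>

type_synonym 'a gen_word = "('a \<times> bool) list"

definition letter_value :: "('a, 'b) monoid_scheme \<Rightarrow> 'a \<times> bool \<Rightarrow> 'a" where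
  "letter_value G l = (if snd l then fst l else inv\<^bsub>G\<^esub> (fst l))"

definition word_value :: "('a, 'b) monoid_scheme \<Rightarrow> 'a gen_word \<Rightarrow> 'a" where
  "word_value G u = foldr (\<lambda>l g. letter_value G l \<otimes>\<^bsub>G\<^esub> g) u \<one>\<^bsub>G\<^esub>"

text \<open>
  Equality of words in the abstract group \<open>\<langle>S | R\<rangle>\<close>: the congruence generated by free cancellation
  and by deletion of relators.
\<close>

inductive presentation_eq :: "'a set \<Rightarrow> 'a gen_word set \<Rightarrow> 'a gen_word \<Rightarrow> 'a gen_word \<Rightarrow> bool"
  for S :: "'a set" and R :: "'a gen_word set" where
  cancel: "s \<in> S \<Longrightarrow> presentation_eq S R (u @ [(s, b), (s, \<not> b)] @ v) (u @ v)"
| relator: "r \<in> R \<Longrightarrow> presentation_eq S R (u @ r @ v) (u @ v)"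
| refl: "presentation_eq S R u u"
| sym: "presentation_eq S R u v \<Longrightarrow> presentation_eq S R v u"
| trans: "presentation_eq S R u v \<Longrightarrow> presentation_eq S R v w \<Longrightarrow> presentation_eq S R u w"

text \<open>
  \<open>G = \<langle>S | R\<rangle>\<close> for \<open>S \<subseteq> G\<close>: the evaluation map from the free group on \<open>S\<close> to \<open>G\<close> is surjective and
  its kernel is the normal closure of \<open>R\<close>.
\<close>

definition has_presentation :: "('a, 'b) monoid_scheme \<Rightarrow> 'a set \<Rightarrow> 'a gen_word set \<Rightarrow> bool" where
  "has_presentation G S R \<longleftrightarrow>
     S \<subseteq> carrier G \<and> R \<subseteq> lists (S \<times> UNIV) \<and> generate G S = carrier G \<and>
     (\<forall>u \<in> lists (S \<times> UNIV). word_value G u = \<one>\<^bsub>G\<^esub> \<longleftrightarrow> presentation_eq S R u [])"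

definition involution :: "('a, 'b) monoid_scheme \<Rightarrow> 'a \<Rightarrow> bool" where
  "involution G x \<longleftrightarrow> x \<in> carrier G \<and> group.ord G x = 2"

text \<open>\<open>group.ord\<close> is \<open>0\<close> on elements of infinite order; such pairs \<open>s, t\<close> contribute no relator.\<close>

definition coxeter_relators :: "('a, 'b) monoid_scheme \<Rightarrow> 'a set \<Rightarrow> 'a gen_word set" where
  "coxeter_relators G S =
     {concat (replicate (group.ord G (s \<otimes>\<^bsub>G\<^esub> t)) [(s, True), (t, True)]) | s t.
        s \<in> S \<and> t \<in> S \<and> group.ord G (s \<otimes>\<^bsub>G\<^esub> t) \<noteq> 0}"

definition coxeter_system :: "('a, 'b) monoid_scheme \<Rightarrow> 'a set \<Rightarrow> bool" where
  "coxeter_system G S \<longleftrightarrow>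
     group G \<and> (\<forall>s \<in> S. involution G s) \<and> has_presentation G S (coxeter_relators G S)"

definition coxeter_group_of_finite_rank :: "('a, 'b) monoid_scheme \<Rightarrow> bool" where
  "coxeter_group_of_finite_rank G \<longleftrightarrow> (\<exists>S. finite S \<and> coxeter_system G S)"

definition maximal_finite_subgroup :: "('a, 'b) monoid_scheme \<Rightarrow> 'a set \<Rightarrow> bool" where
  "maximal_finite_subgroup G M \<longleftrightarrow>
     subgroup M G \<and> finite M \<and> (\<forall>N. subgroup N G \<and> finite N \<and> M \<subseteq> N \<longrightarrow> N = M)"

text \<open>The intersection is taken inside \<open>G\<close>, so that an empty family would give \<open>carrier G\<close>.\<close>

definition finite_continuation :: "('a, 'b) monoid_scheme \<Rightarrow> 'a \<Rightarrow> 'a set" where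
  "finite_continuation G w = carrier G \<inter> \<Inter> {M. maximal_finite_subgroup G M \<and> w \<in> M}"

definition conjugates :: "('a, 'b) monoid_scheme \<Rightarrow> 'a set \<Rightarrow> 'a set" where
  "conjugates G S = {inv\<^bsub>G\<^esub> x \<otimes>\<^bsub>G\<^esub> s \<otimes>\<^bsub>G\<^esub> x | s x. s \<in> S \<and> x \<in> carrier G}"

end

theory Submission
  imports Defs Complex_Main
begin

text \<open>
  The Coxeter group acts linearly on the real functions \<open>x\<close> on its underlying type by the dual geometric
  representation, in which a generator \<open>s\<close> sends \<open>x\<close> to \<open>u \<mapsto> x u + 2 cos (\<pi> / ord (s u)) x s\<close>.
  The functionals \<open>x \<mapsto> (g x) s\<close> play the role of roots, and the reflection
  \<open>g\<^sup>-\<^sup>1 s g\<close> fixes exactly the vectors on which this root vanishes. The theorem is an incidence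
  statement between one root and the fixed vectors of finite subgroups.

  First, every involution \<open>w\<close> sends some root to its negative (\<open>involution_negates_root\<close>): take a
  conjugate \<open>v\<close> of \<open>w\<close> of minimal length and a generator \<open>s\<close> that shortens it. By minimality
  conjugation with \<open>s\<close> does not shorten \<open>v\<close>, so the root \<open>x \<mapsto> (v x) s\<close> is negative on the
  fundamental chamber and positive on the chamber next to it across the wall of \<open>s\<close>. Only multiples
  of the coordinate \<open>s\<close> behave in this way, and \<open>v\<^sup>2 = 1\<close> forces the factor \<open>-1\<close>.

  Secondly, let \<open>M\<close> be a maximal finite subgroup containing \<open>w\<close>, and let \<open>y\<close> be the sum of the
  \<open>M\<close>-orbit of a vector in the fundamental chamber. The stabilizer of \<open>y\<close> is finite
  (\<open>stabilizer_len_bound\<close>) and contains \<open>M\<close>, so it is \<open>M\<close>. As \<open>w\<close> fixes \<open>y\<close>, a root that \<open>w\<close>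
  negates vanishes at \<open>y\<close>, so its reflection fixes \<open>y\<close> and lies in \<open>M\<close>
  (\<open>reflection_in_maximal_finite\<close>).

  The reflection therefore lies in the finite continuation of \<open>w\<close>, which consists of \<open>1\<close> and \<open>w\<close>
  only. It is not \<open>1\<close>, so it is \<open>w\<close>.

  Both steps rest on Tits's theorem \<open>ascent_positive\<close> that the sign of the root \<open>x \<mapsto> (g x) s\<close> on
  the fundamental chamber records whether multiplication by \<open>s\<close> shortens \<open>g\<close>. For the stabilizer,
  it makes the length of \<open>h\<close> the number of half-spaces separating \<open>1\<close> from \<open>h\<close>; if \<open>h\<close> fixes \<open>y\<close>,
  each of these must also separate \<open>1\<close> from some \<open>m \<in> M\<close> or \<open>h m\<close> from \<open>h\<close>, which bounds the length.
\<close>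

section \<open>Dihedral combinatorics\<close>

text \<open>
  Chebyshev polynomials of the second kind, rescaled so that \<open>\<kappa> = 2 cos \<theta>\<close> gives
  \<open>sin (n \<theta>) / sin \<theta>\<close>. Unlike that quotient they also cover \<open>\<theta> = 0\<close>, the case of a product of
  generators of infinite order.
\<close>

fun cheb :: "real \<Rightarrow> nat \<Rightarrow> real" where
  "cheb \<kappa> 0 = 0"
| "cheb \<kappa> (Suc 0) = 1"
| "cheb \<kappa> (Suc (Suc n)) = \<kappa> * cheb \<kappa> (Suc n) - cheb \<kappa> n"

lemma cheb_sin: "sin \<theta> * cheb (2 * cos \<theta>) n = sin (real n * \<theta>)"
proof (induction "2 * cos \<theta>" n rule: cheb.induct)
  case (3 n)
  have e: "real (Suc (Suc n)) * \<theta> = real (Suc n) * \<theta> + \<theta>"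
    "real n * \<theta> = real (Suc n) * \<theta> - \<theta>"
    by (simp_all add: algebra_simps)
  have "sin (real (Suc (Suc n)) * \<theta>) = 2 * cos \<theta> * sin (real (Suc n) * \<theta>) - sin (real n * \<theta>)"
    unfolding e sin_add sin_diff by (simp add: algebra_simps)
  with 3 show ?case by (simp add: algebra_simps)
qed simp_all

lemma cheb_two: "cheb 2 n = real n"
  by (induction "2::real" n rule: cheb.induct) simp_all

lemma rev_in_lists [simp]: "rev xs \<in> lists A \<longleftrightarrow> xs \<in> lists A"
  by auto

fun alt_word :: "'a \<Rightarrow> 'a \<Rightarrow> nat \<Rightarrow> 'a list" where
  "alt_word a b 0 = []"
| "alt_word a b (Suc n) = a # alt_word b a n"

lemma length_alt_word [simp]: "length (alt_word a b n) = n"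
  by (induction n arbitrary: a b) auto

lemma alt_word_in_lists: "a \<in> A \<Longrightarrow> b \<in> A \<Longrightarrow> alt_word a b n \<in> lists A"
  by (induction n arbitrary: a b) auto

lemma alt_word_Suc_right: "alt_word a b (Suc n) = alt_word a b n @ [if even n then a else b]"
  by (induction n arbitrary: a b) auto

lemma alt_word_add: "\<exists>zs. length zs = k \<and> alt_word a b (j + k) = alt_word a b j @ zs
    \<and> set zs \<subseteq> {a, b}"
proof (induction j arbitrary: a b)
  case 0
  have "set (alt_word a b k) \<subseteq> {a,b}" using alt_word_in_lists[of a "{a,b}" b k] by auto
  then show ?case by (intro exI[of _ "alt_word a b k"]) simp
next
  case (Suc j)
  from Suc[of b a] show ?case by (auto simp: insert_commute)
qed

lemma map_alt_word: "map f (alt_word a b n) = alt_word (f a) (f b) n"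
  by (induction n arbitrary: a b) auto

lemma concat_replicate_pair: "concat (replicate m [a, b]) = alt_word a b (2 * m)"
  by (induction m) auto

section \<open>The dual geometric representation\<close>

locale coxeter =
  fixes G :: "('a, 'b) monoid_scheme" (structure) and S :: "'a set"
  assumes system: "coxeter_system G S"

sublocale coxeter \<subseteq> group G
  using system by (simp add: coxeter_system_def)

context coxeter
begin

lemma S_carrier: "s \<in> S \<Longrightarrow> s \<in> carrier G"
  using system by (auto simp: coxeter_system_def involution_def)

lemma S_ord: "s \<in> S \<Longrightarrow> ord s = 2"
  using system by (auto simp: coxeter_system_def involution_def)

lemma S_square: "s \<in> S \<Longrightarrow> s \<otimes> s = \<one>"
  using pow_ord_eq_1[OF S_carrier, of s] S_ord[of s] S_carrier[of s] by (simp add: numeral_2_eq_2)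

lemma S_inv: "s \<in> S \<Longrightarrow> inv s = s"
  by (simp add: S_carrier S_square inv_equality)

lemma S_not_one: "s \<in> S \<Longrightarrow> s \<noteq> \<one>"
  using S_ord by fastforce

lemma S_cancel: "s \<in> S \<Longrightarrow> g \<in> carrier G \<Longrightarrow> s \<otimes> (s \<otimes> g) = g"
  by (simp add: m_assoc[symmetric] S_carrier S_square)

lemma S_cancel_right: "s \<in> S \<Longrightarrow> g \<in> carrier G \<Longrightarrow> g \<otimes> s \<otimes> s = g"
  by (simp add: m_assoc S_carrier S_square)

definition wprod :: "'a list \<Rightarrow> 'a" where
  "wprod xs = foldr (\<lambda>s g. s \<otimes> g) xs \<one>"

lemma wprod_simps [simp]: "wprod [] = \<one>" "wprod (s # xs) = s \<otimes> wprod xs"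
  by (simp_all add: wprod_def)

lemma wprod_carrier: "xs \<in> lists S \<Longrightarrow> wprod xs \<in> carrier G"
  by (induction xs) (auto simp: S_carrier)

lemma wprod_append:
  "xs \<in> lists S \<Longrightarrow> ys \<in> lists S \<Longrightarrow> wprod (xs @ ys) = wprod xs \<otimes> wprod ys"
  by (induction xs) (auto simp: S_carrier wprod_carrier m_assoc)

lemma wprod_rev: "xs \<in> lists S \<Longrightarrow> wprod (rev xs) = inv (wprod xs)"
proof (induction xs)
  case (Cons s xs)
  then have "wprod (rev (s # xs)) = wprod (rev xs) \<otimes> wprod [s]"
    by (simp only: rev.simps) (rule wprod_append, auto)
  with Cons show ?case by (auto simp: inv_mult_group S_carrier wprod_carrier S_inv)
qed simp

lemma word_exists:
  assumes "g \<in> carrier G" shows "\<exists>xs \<in> lists S. wprod xs = g"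
proof -
  have "g \<in> generate G S"
    using system assms by (simp add: coxeter_system_def has_presentation_def)
  then show ?thesis
  proof (induction rule: generate.induct)
    case one show ?case by (rule bexI[of _ "[]"]) auto
  next
    case (incl s) then show ?case by (intro bexI[of _ "[s]"]) (auto simp: S_carrier)
  next
    case (inv s) then show ?case by (intro bexI[of _ "[s]"]) (auto simp: S_carrier S_inv)
  next
    case (eng g h)
    then obtain xs ys where "xs \<in> lists S" "wprod xs = g" "ys \<in> lists S" "wprod ys = h" by blast
    then show ?case by (intro bexI[of _ "xs @ ys"]) (auto simp: wprod_append)
  qed
qed

text \<open>
  Minus twice the Coxeter bilinear form. An infinite order is encoded as \<open>0\<close>, and division by zero
  then gives \<open>2 cos 0 = 2\<close>, which is the usual value for that case. The second argument ranges over
  the whole type, so that the group acts on plain functions; the coordinates outside \<open>S\<close> are carried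
  along and satisfy the same relations.
\<close>

definition coupling :: "'a \<Rightarrow> 'a \<Rightarrow> real" where
  "coupling s u = 2 * cos (pi / real (ord (s \<otimes> u)))"

definition sigma :: "'a \<Rightarrow> ('a \<Rightarrow> real) \<Rightarrow> 'a \<Rightarrow> real" where
  "sigma s x = (\<lambda>u. x u + coupling s u * x s)"

definition act :: "'a list \<Rightarrow> ('a \<Rightarrow> real) \<Rightarrow> 'a \<Rightarrow> real" where
  "act xs x = foldr sigma xs x"

lemma act_simps [simp]: "act [] x = x" "act (s # xs) x = sigma s (act xs x)"
  by (simp_all add: act_def)

lemma act_append: "act (xs @ ys) x = act xs (act ys x)"
  by (simp add: act_def)

lemma coupling_self: "s \<in> S \<Longrightarrow> coupling s s = - 2"
  by (simp add: coupling_def S_square)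

lemma ord_commute: "s \<in> S \<Longrightarrow> t \<in> S \<Longrightarrow> ord (t \<otimes> s) = ord (s \<otimes> t)"
  using ord_inv[of "s \<otimes> t"] by (simp add: inv_mult_group S_carrier S_inv)

lemma coupling_commute: "s \<in> S \<Longrightarrow> t \<in> S \<Longrightarrow> coupling t s = coupling s t"
  by (simp add: coupling_def ord_commute)

lemma ord_not_one:
  assumes "s \<in> S" "t \<in> S" "s \<noteq> t" shows "ord (s \<otimes> t) \<noteq> 1"
proof
  assume "ord (s \<otimes> t) = 1"
  then have "s \<otimes> t = \<one>" using assms ord_eq_1[of "s \<otimes> t"] by (simp add: S_carrier)
  then have "s = inv t" using assms inv_equality S_carrier by metis
  with assms show False by (simp add: S_inv)
qed

lemma sigma_self: "s \<in> S \<Longrightarrow> sigma s x s = - x s"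
  by (simp add: sigma_def coupling_self)

lemma sigma_sigma: "s \<in> S \<Longrightarrow> sigma s (sigma s x) = x"
  by (rule ext) (simp add: sigma_def coupling_self algebra_simps)

lemma sigma_fixes: "x s = 0 \<Longrightarrow> sigma s x = x"
  by (simp add: sigma_def)

lemma sigma_linear: "sigma s (\<lambda>u. a * x u + y u) = (\<lambda>u. a * sigma s x u + sigma s y u)"
  by (rule ext) (simp add: sigma_def algebra_simps)

lemma act_linear: "act xs (\<lambda>u. a * x u + y u) = (\<lambda>u. a * act xs x u + act xs y u)"
  by (induction xs) (simp_all add: sigma_linear)

text \<open>
  The two coordinates \<open>s\<close> and \<open>t\<close> evolve among themselves under the dihedral group generated by
  \<open>s\<close> and \<open>t\<close>. For finite order, with \<open>\<theta> = \<pi> / ord (s t)\<close>, the coefficients of the closed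
  formula are \<open>sin (k \<theta>) / sin \<theta>\<close>; both the dihedral relation and the positivity of short
  alternating words are read off from it.
\<close>

lemma act_alt_word:
  assumes "s \<in> S" "t \<in> S"
  defines "\<kappa> \<equiv> coupling s t"
  defines "p \<equiv> \<lambda>n s t (y :: 'a \<Rightarrow> real). if even n then y s else y t"
  shows "act (alt_word t s n) y s = cheb \<kappa> (Suc n) * p n s t y + cheb \<kappa> n * p n t s y"
    and "act (alt_word t s n) y t = (cheb \<kappa> (Suc n) - \<kappa> * cheb \<kappa> n) * p n t s y - cheb \<kappa> n * p n s t y"
proof -
  have "act (alt_word t s n) y s = cheb \<kappa> (Suc n) * p n s t y + cheb \<kappa> n * p n t s y \<and>
        act (alt_word t s n) y t = (cheb \<kappa> (Suc n) - \<kappa> * cheb \<kappa> n) * p n t s y - cheb \<kappa> n * p n s t y"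
    if "s \<in> S" "t \<in> S" "coupling s t = \<kappa>" for s t
    using that
  proof (induction n arbitrary: s t)
    case 0 then show ?case by (simp add: p_def)
  next
    case (Suc n)
    let ?x = "act (alt_word s t n) y"
    have c: "coupling t s = \<kappa>" using Suc.prems by (simp add: coupling_commute)
    have e: "p (Suc n) s t y = p n t s y" "p (Suc n) t s y = p n s t y" by (simp_all add: p_def)
    have IH: "?x t = cheb \<kappa> (Suc n) * p n t s y + cheb \<kappa> n * p n s t y"
      "?x s = (cheb \<kappa> (Suc n) - \<kappa> * cheb \<kappa> n) * p n s t y - cheb \<kappa> n * p n t s y"
      using Suc.IH[of t s] Suc.prems c by blast+
    have "sigma t ?x t = - ?x t" using Suc.prems by (simp add: sigma_self)
    moreover have "sigma t ?x s = ?x s + \<kappa> * ?x t" by (simp add: sigma_def c)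
    ultimately show ?case unfolding e alt_word.simps act_simps IH by (simp add: algebra_simps)
  qed
  with assms show "act (alt_word t s n) y s = cheb \<kappa> (Suc n) * p n s t y + cheb \<kappa> n * p n t s y"
    and "act (alt_word t s n) y t = (cheb \<kappa> (Suc n) - \<kappa> * cheb \<kappa> n) * p n t s y - cheb \<kappa> n * p n s t y"
    by blast+
qed

text \<open>
  On the coordinates \<open>s\<close> and \<open>t\<close> the word is a rotation by a full turn. For any other coordinate
  \<open>u\<close>, the Gram matrix of \<open>s\<close> and \<open>t\<close> is invertible, so some combination \<open>x u + l x s + n x t\<close> is
  invariant under both generators, and \<open>x u\<close> is recovered from invariant quantities.
\<close>

lemma dihedral_relation:
  assumes "s \<in> S" "t \<in> S" "s \<noteq> t" "ord (s \<otimes> t) \<noteq> 0"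
  shows "act (alt_word s t (2 * ord (s \<otimes> t))) x = x"
proof -
  define m where "m = ord (s \<otimes> t)"
  define \<theta> where "\<theta> = pi / real m"
  define \<kappa> where "\<kappa> = coupling t s"
  have \<kappa>: "\<kappa> = 2 * cos \<theta>" "coupling s t = \<kappa>"
    using assms by (simp_all add: \<kappa>_def coupling_def \<theta>_def m_def ord_commute)
  have m2: "m \<ge> 2" using ord_not_one[OF assms(1-3)] assms(4) by (simp add: m_def)
  then have "0 < \<theta>" "\<theta> < pi" by (auto simp: \<theta>_def divide_simps)
  then have s0: "sin \<theta> > 0" by (rule sin_gt_zero)
  have mt: "real (2 * m) * \<theta> = 2 * pi" "real (Suc (2 * m)) * \<theta> = 2 * pi + \<theta>"
    using m2 by (simp_all add: \<theta>_def field_simps)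
  have "sin \<theta> * cheb \<kappa> (2 * m) = 0" "sin \<theta> * cheb \<kappa> (Suc (2 * m)) = sin \<theta>"
    unfolding \<kappa> cheb_sin mt by (simp_all add: sin_add)
  with s0 have U: "cheb \<kappa> (2 * m) = 0" "cheb \<kappa> (Suc (2 * m)) = 1" by simp_all
  let ?w = "alt_word s t (2 * m)"
  have fixes_st: "act ?w x s = x s" "act ?w x t = x t"
    using act_alt_word[OF assms(2,1), of "2*m" x] U by (simp_all add: \<kappa>_def)
  show ?thesis
  proof
    fix u
    have "\<kappa>\<^sup>2 = 4 * (cos \<theta>)\<^sup>2" by (simp add: \<kappa> power2_eq_square)
    also have "\<dots> = 4 - 4 * (sin \<theta>)\<^sup>2" by (simp add: cos_squared_eq)
    finally have d: "4 - \<kappa> * \<kappa> \<noteq> 0" using s0 by (simp add: power2_eq_square)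
    \<comment> \<open>The solution of the two linear equations below, by Cramer's rule.\<close>
    define l where "l = (2 * coupling s u + \<kappa> * coupling t u) / (4 - \<kappa> * \<kappa>)"
    define n where "n = (2 * coupling t u + \<kappa> * coupling s u) / (4 - \<kappa> * \<kappa>)"
    have l: "2 * l - \<kappa> * n = coupling s u" and n: "2 * n - \<kappa> * l = coupling t u"
      using d unfolding l_def n_def by (simp_all add: divide_simps) (simp_all add: algebra_simps)
    have "act v y u + l * act v y s + n * act v y t = y u + l * y s + n * y t"
      if "v \<in> lists {s, t}" for v y
      using that
    proof (induction v)
      case (Cons a v)
      then consider "a = s" | "a = t" by auto
      then show ?case
      proof cases
        case 1
        have "sigma s z u + l * sigma s z s + n * sigma s z t = z u + l * z s + n * z t" for z
          using assms \<kappa> unfolding sigma_def l[symmetric] by (simp add: coupling_self algebra_simps)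
        with Cons 1 show ?thesis by simp
      next
        case 2
        have "sigma t z u + l * sigma t z s + n * sigma t z t = z u + l * z s + n * z t" for z
          using assms \<kappa>_def unfolding sigma_def n[symmetric] by (simp add: coupling_self algebra_simps)
        with Cons 2 show ?thesis by simp
      qed
    qed simp
    from this[of ?w x] alt_word_in_lists[of s "{s,t}" t] fixes_st
    show "act (alt_word s t (2 * ord (s \<otimes> t))) x u = x u" by (simp add: m_def)
  qed
qed

lemma presentation_eq_act:
  assumes "presentation_eq S (coxeter_relators G S) u v"
  shows "act (map fst u) = act (map fst v)"
  using assms
proof (induction rule: presentation_eq.induct)
  case (cancel s u b v)
  then show ?case by (auto simp: act_append sigma_sigma)
next
  case (relator r u v)
  then obtain s t where st: "s \<in> S" "t \<in> S" "ord (s \<otimes> t) \<noteq> 0"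
    and r: "r = concat (replicate (ord (s \<otimes> t)) [(s, True), (t, True)])"
    by (auto simp: coxeter_relators_def)
  have "map fst r = alt_word s t (2 * ord (s \<otimes> t))"
    unfolding r by (simp add: concat_replicate_pair map_alt_word)
  moreover have "act (alt_word s t (2 * ord (s \<otimes> t))) x = x" for x
  proof (cases "s = t")
    case True
    with st show ?thesis by (simp add: S_square numeral_2_eq_2 sigma_sigma)
  next
    case False with st show ?thesis by (simp add: dihedral_relation)
  qed
  ultimately show ?case by (auto simp: act_append)
qed simp_all

lemma word_value_eq_wprod: "word_value G (map (\<lambda>s. (s, True)) xs) = wprod xs"
  by (induction xs) (auto simp: word_value_def letter_value_def)

lemma act_rev: "ys \<in> lists S \<Longrightarrow> act (rev ys) (act ys x) = x"
  by (induction ys arbitrary: x) (auto simp: act_append sigma_sigma)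

text \<open>
  This is where the presentation is used: a word that represents the identity is derivable from
  relators that act trivially.
\<close>

lemma act_cong:
  assumes "xs \<in> lists S" "ys \<in> lists S" "wprod xs = wprod ys"
  shows "act xs = act ys"
proof
  fix x
  let ?u = "map (\<lambda>s. (s, True)) (rev ys @ xs)"
  have "word_value G ?u = \<one>"
    unfolding word_value_eq_wprod using wprod_append[of "rev ys" xs] assms wprod_rev[of ys]
      wprod_carrier[of ys] by simp
  moreover have "?u \<in> lists (S \<times> UNIV)" using assms by auto
  ultimately have "presentation_eq S (coxeter_relators G S) ?u []"
    using system by (simp add: coxeter_system_def has_presentation_def)
  from presentation_eq_act[OF this] have "act (rev ys @ xs) = act []" by (simp add: comp_def)
  then have "act (rev ys) (act xs x) = x" by (metis act_append act_simps(1))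
  moreover have "act ys (act (rev ys) z) = z" for z
    using act_rev[of "rev ys" z] assms by simp
  ultimately show "act xs x = act ys x" by metis
qed

definition rep :: "'a \<Rightarrow> ('a \<Rightarrow> real) \<Rightarrow> 'a \<Rightarrow> real" where
  "rep g = act (SOME xs. xs \<in> lists S \<and> wprod xs = g)"

lemma rep_wprod: "xs \<in> lists S \<Longrightarrow> rep (wprod xs) = act xs"
  unfolding rep_def
  by (rule someI2[of "\<lambda>ys. ys \<in> lists S \<and> wprod ys = wprod xs" xs])
     (auto intro: act_cong simp del: in_lists_conv_set)

lemma rep_one: "rep \<one> x = x"
  using rep_wprod[of "[]"] by simp

lemma rep_gen: "s \<in> S \<Longrightarrow> rep s = sigma s"
  using rep_wprod[of "[s]"] by (simp add: S_carrier fun_eq_iff)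

lemma rep_mult:
  assumes "g \<in> carrier G" "h \<in> carrier G"
  shows "rep (g \<otimes> h) x = rep g (rep h x)"
proof -
  obtain xs ys where "xs \<in> lists S" "wprod xs = g" "ys \<in> lists S" "wprod ys = h"
    using assms word_exists by meson
  then show ?thesis
    using rep_wprod[of xs] rep_wprod[of ys] rep_wprod[of "xs @ ys"]
    by (auto simp: wprod_append act_append)
qed

lemma rep_linear: "rep g (\<lambda>u. a * x u + y u) = (\<lambda>u. a * rep g x u + rep g y u)"
  by (simp add: rep_def act_linear)

section \<open>Length and positivity\<close>

definition len :: "'a \<Rightarrow> nat" where
  "len g = (LEAST n. \<exists>xs \<in> lists S. length xs = n \<and> wprod xs = g)"

lemma len_wprod_le: "xs \<in> lists S \<Longrightarrow> len (wprod xs) \<le> length xs"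
  unfolding len_def by (rule Least_le) blast

lemma reduced_word:
  assumes "g \<in> carrier G"
  obtains xs where "xs \<in> lists S" "length xs = len g" "wprod xs = g"
proof -
  have "\<exists>n. \<exists>xs \<in> lists S. length xs = n \<and> wprod xs = g"
    using word_exists[OF assms] by blast
  from LeastI_ex[OF this] show ?thesis using that unfolding len_def by blast
qed

lemma len_mult_le:
  assumes "g \<in> carrier G" "h \<in> carrier G" shows "len (g \<otimes> h) \<le> len g + len h"
proof -
  obtain xs where x: "xs \<in> lists S" "length xs = len g" "wprod xs = g"
    using reduced_word[OF assms(1)] .
  obtain ys where y: "ys \<in> lists S" "length ys = len h" "wprod ys = h"
    using reduced_word[OF assms(2)] .
  from x y len_wprod_le[of "xs @ ys"] wprod_append[of xs ys] show ?thesis by simp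
qed

lemma len_gen_le: "s \<in> S \<Longrightarrow> len s \<le> 1"
  using len_wprod_le[of "[s]"] by (simp add: S_carrier)

lemma len_one: "len \<one> = 0"
  using len_wprod_le[of "[]"] by simp

lemma len_inv_le: assumes "g \<in> carrier G" shows "len (inv g) \<le> len g"
proof -
  obtain xs where x: "xs \<in> lists S" "length xs = len g" "wprod xs = g"
    using reduced_word[OF assms] .
  with len_wprod_le[of "rev xs"] wprod_rev[of xs] show ?thesis by simp
qed

lemma len_inv: "g \<in> carrier G \<Longrightarrow> len (inv g) = len g"
  using len_inv_le[of g] len_inv_le[of "inv g"] by simp

lemma len_right_eq_left:
  "s \<in> S \<Longrightarrow> g \<in> carrier G \<Longrightarrow> len (g \<otimes> s) = len (s \<otimes> inv g)"
  using len_inv[of "g \<otimes> s"] by (simp add: inv_mult_group S_carrier S_inv)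

lemma len_le_Suc_gen_mult:
  assumes "s \<in> S" "g \<in> carrier G" shows "len g \<le> Suc (len (s \<otimes> g))"
  using len_mult_le[of s "s \<otimes> g"] len_gen_le[of s] assms by (simp add: S_carrier S_cancel)

lemma left_descent_exists:
  assumes "g \<in> carrier G" "g \<noteq> \<one>" shows "\<exists>s \<in> S. len (s \<otimes> g) < len g"
proof -
  obtain xs where x: "xs \<in> lists S" "length xs = len g" "wprod xs = g"
    using reduced_word[OF assms(1)] .
  with assms obtain s ys where e: "xs = s # ys" by (cases xs) auto
  with x have s: "s \<in> S" "ys \<in> lists S" by auto
  have "s \<otimes> g = wprod ys" using x e s S_cancel[of s "wprod ys"] wprod_carrier[of ys] by auto
  with len_wprod_le[OF s(2)] x(2) e s show ?thesis by (intro bexI[of _ s]) auto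
qed

text \<open>The open fundamental chamber.\<close>

definition dominant :: "('a \<Rightarrow> real) \<Rightarrow> bool" where
  "dominant x \<longleftrightarrow> (\<forall>s \<in> S. x s > 0)"

text \<open>
  An alternating word of fewer than \<open>ord (s t)\<close> letters turns the chamber by less than half a turn,
  so the Chebyshev coefficients \<open>sin (k \<theta>) / sin \<theta>\<close> of both coordinates are nonnegative. For
  infinite order the coefficients are natural numbers.
\<close>

lemma dihedral_positive:
  assumes "s \<in> S" "t \<in> S" "s \<noteq> t" "y s > 0" "y t > 0"
    and n: "ord (s \<otimes> t) = 0 \<or> n < ord (s \<otimes> t)"
  shows "act (alt_word t s n) y s > 0"
proof -
  define \<kappa> where "\<kappa> = coupling s t"
  have "cheb \<kappa> (Suc n) \<ge> 0 \<and> cheb \<kappa> n \<ge> 0 \<and> (cheb \<kappa> (Suc n) > 0 \<or> cheb \<kappa> n > 0)"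
  proof (cases "ord (s \<otimes> t) = 0")
    case True
    then have "\<kappa> = 2" by (simp add: \<kappa>_def coupling_def)
    then show ?thesis using cheb_two[of "Suc n"] by (simp add: cheb_two del: cheb.simps)
  next
    case False
    define m where "m = ord (s \<otimes> t)"
    define \<theta> where "\<theta> = pi / real m"
    have \<kappa>: "\<kappa> = 2 * cos \<theta>" by (simp add: \<kappa>_def coupling_def \<theta>_def m_def)
    have m2: "m \<ge> 2" using ord_not_one[OF assms(1-3)] False by (simp add: m_def)
    have nm: "n < m" using n False by (simp add: m_def)
    have "0 < \<theta>" "\<theta> < pi" using m2 by (auto simp: \<theta>_def divide_simps)
    then have s0: "sin \<theta> > 0" by (rule sin_gt_zero)
    have le: "real k * \<theta> \<le> pi" if "k \<le> m" for k
      using that m2 by (simp add: \<theta>_def divide_simps)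
    have nn: "cheb \<kappa> k \<ge> 0" if "k \<le> m" for k
    proof -
      have "sin (real k * \<theta>) \<ge> 0" using le[OF that] \<open>0 < \<theta>\<close> by (intro sin_ge_zero) auto
      then have "0 \<le> sin \<theta> * cheb \<kappa> k" by (simp add: \<kappa> cheb_sin)
      with s0 show ?thesis by (simp add: zero_le_mult_iff)
    qed
    have "cheb \<kappa> n > 0" if "n > 0"
    proof -
      have "real n * \<theta> < pi" using nm m2 by (simp add: \<theta>_def divide_simps)
      then have "sin (real n * \<theta>) > 0" using \<open>0 < \<theta>\<close> that by (intro sin_gt_zero) auto
      then have "0 < sin \<theta> * cheb \<kappa> n" by (simp add: \<kappa> cheb_sin)
      with s0 show ?thesis by (simp add: zero_less_mult_iff)
    qed
    then have "cheb \<kappa> (Suc n) > 0 \<or> cheb \<kappa> n > 0" by (cases n) auto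
    with nn[of n] nn[of "Suc n"] nm show ?thesis by auto
  qed
  then show ?thesis
    unfolding act_alt_word(1)[OF assms(1,2)] \<kappa>_def[symmetric]
    using assms(4,5) by (auto intro: add_pos_nonneg add_nonneg_pos simp del: cheb.simps)
qed

lemma wprod_alt_word_even:
  assumes "s \<in> S" "t \<in> S" shows "wprod (alt_word s t (2 * n)) = (s \<otimes> t) [^] n"
proof (induction n)
  case (Suc n)
  have c: "s \<otimes> t \<in> carrier G" using assms by (simp add: S_carrier)
  have "wprod (alt_word s t (2 * Suc n)) = (s \<otimes> t) \<otimes> wprod (alt_word s t (2 * n))"
    using assms wprod_carrier[OF alt_word_in_lists[of s S t]] by (simp add: m_assoc S_carrier)
  with Suc show ?case using nat_pow_Suc2[OF c] by simp
qed simp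

text \<open>
  The braid relation lets an alternating word of at least \<open>m = ord (s t)\<close> letters start with either
  generator: preceded by \<open>s\<close>, its first \<open>m\<close> letters form a segment of \<open>m + 1\<close> letters of the
  relator, which equals the inverse of the remaining \<open>m - 1\<close> letters.
\<close>

lemma alt_word_shorten:
  assumes st: "s \<in> S" "t \<in> S" and m: "ord (s \<otimes> t) \<noteq> 0" "ord (s \<otimes> t) \<le> k"
  shows "len (s \<otimes> wprod (alt_word t s k)) < k"
proof -
  define m where "m = ord (s \<otimes> t)"
  have m0: "m > 0" "m \<le> k" using m by (auto simp: m_def)
  obtain zs where z: "length zs = k - m" "alt_word t s k = alt_word t s m @ zs" "set zs \<subseteq> {t, s}"
    using alt_word_add[of "k - m" t s m] m0 by auto
  obtain ys where y: "length ys = m - 1" "alt_word s t (2 * m) = alt_word s t (Suc m) @ ys"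
    "set ys \<subseteq> {s, t}"
    using alt_word_add[of "m - 1" s t "Suc m"] m0 by (auto simp: mult_2)
  have L: "zs \<in> lists S" "ys \<in> lists S" "rev ys \<in> lists S"
    "alt_word t s m \<in> lists S" "alt_word s t (Suc m) \<in> lists S"
    using z y st alt_word_in_lists[of t S s m] alt_word_in_lists[of s S t "Suc m"] by auto
  have "wprod (alt_word s t (Suc m)) \<otimes> wprod ys = wprod (alt_word s t (2 * m))"
    unfolding y(2) using L by (simp only: wprod_append)
  also have "\<dots> = \<one>"
    using wprod_alt_word_even[OF st, of m] pow_ord_eq_1[of "s \<otimes> t"] st by (simp add: m_def S_carrier)
  finally have "wprod (alt_word s t (Suc m)) = inv (wprod ys)"
    using inv_equality wprod_carrier L by metis
  then have "s \<otimes> wprod (alt_word t s m) = wprod (rev ys)"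
    using wprod_rev[OF L(2)] by simp
  moreover have "s \<otimes> wprod (alt_word t s k) = s \<otimes> wprod (alt_word t s m) \<otimes> wprod zs"
    unfolding z(2) using L wprod_append[OF L(4,1)] wprod_carrier[OF L(4)] wprod_carrier[OF L(1)] st
    by (simp add: m_assoc S_carrier)
  ultimately have "s \<otimes> wprod (alt_word t s k) = wprod (rev ys @ zs)"
    using wprod_append[OF L(3,1)] by simp
  then show ?thesis
    using len_wprod_le[of "rev ys @ zs"] L z(1) y(1) m0 by simp
qed

text \<open>
  Tits's theorem. If \<open>t\<close> shortens \<open>g\<close>, split off from the left of \<open>g\<close> the longest possible reduced
  alternating word \<open>t s t \<dots>\<close>, leaving \<open>h\<close>. Neither \<open>s\<close> nor \<open>t\<close> can shorten \<open>h\<close>, so by induction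
  both coordinates of \<open>h x\<close> are positive. The split word is shorter than \<open>ord (s t)\<close>, because
  otherwise it could be rewritten to start with \<open>s\<close> and \<open>s\<close> would shorten \<open>g\<close>. The claim is thus
  reduced to a dihedral computation.
\<close>

lemma ascent_positive:
  assumes "g \<in> carrier G" "s \<in> S" "len g \<le> len (s \<otimes> g)" "dominant x"
  shows "rep g x s > 0"
  using assms
proof (induction "len g" arbitrary: g s rule: less_induct)
  case less
  show ?case
  proof (cases "g = \<one>")
    case True
    with less.prems show ?thesis by (simp add: rep_one dominant_def)
  next
    case False
    then obtain t where t: "t \<in> S" "len (t \<otimes> g) < len g"
      using left_descent_exists less.prems by blast
    with less.prems have "s \<noteq> t" by auto
    define P where "P = (\<lambda>k. \<exists>h \<in> carrier G. g = wprod (alt_word t s k) \<otimes> h \<and> len g = k + len h)"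
    have alt_c: "wprod (alt_word t s k) \<in> carrier G" for k
      using wprod_carrier alt_word_in_lists t(1) less.prems(2) by metis
    have alt_len: "len (wprod (alt_word t s k)) \<le> k" for k
      using len_wprod_le[of "alt_word t s k"] alt_word_in_lists[of t S s k] t(1) less.prems(2) by simp
    have alt_Suc: "wprod (alt_word t s (Suc k)) = wprod (alt_word t s k) \<otimes> (if even k then t else s)" for k
      using wprod_append[of "alt_word t s k" "[if even k then t else s]"]
        alt_word_in_lists[of t S s k] t(1) less.prems(2)
      unfolding alt_word_Suc_right by (auto simp: S_carrier)
    have "P 1" unfolding P_def
      using t less.prems len_le_Suc_gen_mult[of t g]
      by (intro bexI[of _ "t \<otimes> g"]) (auto simp: S_carrier S_cancel)
    have "\<forall>k. P k \<longrightarrow> k \<le> len g" by (auto simp: P_def)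
    define k where "k = Greatest P"
    have "P k" and k_max: "\<And>j. P j \<Longrightarrow> j \<le> k"
      unfolding k_def using GreatestI_nat[of P] Greatest_le_nat[of P] \<open>P 1\<close> \<open>\<forall>k. P k \<longrightarrow> k \<le> len g\<close>
      by blast+
    have "k \<ge> 1" using k_max \<open>P 1\<close> by blast
    from \<open>P k\<close> obtain h where h: "h \<in> carrier G" "g = wprod (alt_word t s k) \<otimes> h" "len g = k + len h"
      by (auto simp: P_def)
    \<comment> \<open>Maximality of \<open>k\<close> handles the letter that would continue the alternating word.\<close>
    have up_next: "len h \<le> len (u \<otimes> h)" if u: "u = (if even k then t else s)" for u
    proof (rule ccontr)
      assume "\<not> ?thesis"
      moreover have "u \<in> S" using u t less.prems by simp
      ultimately have l: "len h = Suc (len (u \<otimes> h))"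
        using len_le_Suc_gen_mult[of u h] h(1) by simp
      have "wprod (alt_word t s (Suc k)) \<otimes> (u \<otimes> h) = wprod (alt_word t s k) \<otimes> (u \<otimes> (u \<otimes> h))"
        unfolding alt_Suc u[symmetric] using \<open>u \<in> S\<close> h(1) alt_c[of k] by (simp add: m_assoc S_carrier)
      then have "P (Suc k)" unfolding P_def
        using h l \<open>u \<in> S\<close> by (intro bexI[of _ "u \<otimes> h"]) (auto simp: S_cancel S_carrier)
      then show False using k_max by fastforce
    qed
    \<comment> \<open>The last letter of the word cannot shorten \<open>h\<close> because the factorization is reduced.\<close>
    have up_prev: "len h \<le> len (u \<otimes> h)" if u: "u = (if even k then s else t)" for u
    proof -
      obtain j where j: "k = Suc j" using \<open>k \<ge> 1\<close> by (cases k) auto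
      have "u \<in> S" using u t less.prems by simp
      have "g = wprod (alt_word t s j) \<otimes> (u \<otimes> h)"
        using h alt_Suc[of j] alt_c[of j] \<open>u \<in> S\<close> u by (auto simp: j m_assoc S_carrier)
      then have "len g \<le> j + len (u \<otimes> h)"
        using len_mult_le[of "wprod (alt_word t s j)" "u \<otimes> h"] alt_len[of j] alt_c[of j] h(1) \<open>u \<in> S\<close>
        by (simp add: S_carrier)
      then show ?thesis using h(3) j by simp
    qed
    have "len h \<le> len (s \<otimes> h)" "len h \<le> len (t \<otimes> h)"
      using up_next up_prev by (cases "even k"; simp)+
    then have pos: "rep h x s > 0" "rep h x t > 0"
      using less.hyps[of h s] less.hyps[of h t] h \<open>k \<ge> 1\<close> less.prems t by auto
    have "ord (s \<otimes> t) = 0 \<or> k < ord (s \<otimes> t)"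
    proof (rule ccontr)
      assume "\<not> ?thesis"
      then have "len (s \<otimes> wprod (alt_word t s k)) < k"
        using alt_word_shorten less.prems t by simp
      moreover have "s \<otimes> g = s \<otimes> wprod (alt_word t s k) \<otimes> h"
        using h alt_c[of k] less.prems by (simp add: m_assoc S_carrier)
      ultimately have "len (s \<otimes> g) < k + len h"
        using len_mult_le[of "s \<otimes> wprod (alt_word t s k)" h] h alt_c[of k] less.prems
        by (simp add: S_carrier)
      with h less.prems show False by simp
    qed
    from dihedral_positive[where y = "rep h x", OF less.prems(2) t(1) \<open>s \<noteq> t\<close> pos this]
    have "act (alt_word t s k) (rep h x) s > 0" .
    moreover have "rep g x = act (alt_word t s k) (rep h x)"
      using rep_mult[OF alt_c[of k] h(1)] rep_wprod[of "alt_word t s k"]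
        alt_word_in_lists[of t S s k] t less.prems h(2) by simp
    ultimately show ?thesis by simp
  qed
qed

lemma descent_negative:
  assumes "g \<in> carrier G" "s \<in> S" "len (s \<otimes> g) < len g" "dominant x"
  shows "rep g x s < 0"
proof -
  have "rep (s \<otimes> g) x s > 0"
    using assms by (intro ascent_positive) (auto simp: S_carrier S_cancel)
  with assms show ?thesis by (simp add: rep_mult S_carrier rep_gen sigma_self)
qed

lemma rep_coord_pos_iff:
  "g \<in> carrier G \<Longrightarrow> s \<in> S \<Longrightarrow> dominant x \<Longrightarrow> rep g x s > 0 \<longleftrightarrow> len g \<le> len (s \<otimes> g)"
  using ascent_positive[of g s x] descent_negative[of g s x] by linarith

lemma rep_coord_neg_iff:
  "g \<in> carrier G \<Longrightarrow> s \<in> S \<Longrightarrow> dominant x \<Longrightarrow> rep g x s < 0 \<longleftrightarrow> len (s \<otimes> g) < len g"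
  using ascent_positive[of g s x] descent_negative[of g s x] by linarith

lemma dominant_one: "dominant (\<lambda>_. 1)"
  by (simp add: dominant_def)

text \<open>
  A root that changes sign between the fundamental chamber and its neighbour across the wall of \<open>s\<close>
  vanishes on the common face of their closures by a limit argument. This face spans the hyperplane
  \<open>x s = 0\<close>, since any vector is a difference of nonnegative ones. Arguing with vectors instead of
  coefficients makes the lemma independent of the number of generators.
\<close>

lemma wall_functional:
  fixes f :: "('a \<Rightarrow> real) \<Rightarrow> real"
  assumes lin: "\<And>a x y. f (\<lambda>u. a * x u + y u) = a * f x + f y"
    and s: "s \<in> S"
    and pos: "\<And>x. dominant x \<Longrightarrow> f x > 0"
    and neg: "\<And>x. dominant x \<Longrightarrow> f (sigma s x) < 0"
  shows "f x = f (\<lambda>_. 1) * x s"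
proof -
  define p where "p = f (\<lambda>_. 1)"
  define q where "q = f (sigma s (\<lambda>_. 1))"
  have p: "p > 0" and q: "q < 0" using pos neg dominant_one by (auto simp: p_def q_def)
  have nonneg: "f z = 0" if z: "z s = 0" "\<And>u. z u \<ge> 0" for z
  proof -
    have both: "e * p + f z > 0 \<and> e * q + f z < 0" if "e > 0" for e
    proof -
      have d: "dominant (\<lambda>u. e * 1 + z u)"
        using that z(2) by (auto simp: dominant_def intro: add_pos_nonneg)
      have "f (\<lambda>u. e * 1 + z u) = e * p + f z" using lin[of e "\<lambda>_. 1" z] by (simp add: p_def)
      moreover have "f (sigma s (\<lambda>u. e * 1 + z u)) = e * q + f z"
        using sigma_linear[of s e "\<lambda>_. 1" z] lin[of e "sigma s (\<lambda>_. 1)" z] sigma_fixes[of z s] z(1)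
        by (simp add: q_def)
      ultimately show ?thesis using pos[OF d] neg[OF d] by simp
    qed
    have "\<not> f z < 0"
    proof
      assume "f z < 0"
      \<comment> \<open>At this value of \<open>e\<close> the first inequality degenerates to \<open>0 > 0\<close>.\<close>
      with both[of "- f z / p"] p show False by (simp add: divide_neg_pos)
    qed
    moreover have "\<not> f z > 0"
    proof
      assume "f z > 0"
      with both[of "- f z / q"] q show False by (simp add: divide_pos_neg)
    qed
    ultimately show ?thesis by simp
  qed
  have vanish: "f z = 0" if "z s = 0" for z
  proof -
    have "z = (\<lambda>u. (-1) * max (- z u) 0 + max (z u) 0)" by (auto simp: max_def)
    then have "f z = (-1) * f (\<lambda>u. max (- z u) 0) + f (\<lambda>u. max (z u) 0)"
      using lin[of "-1" "\<lambda>u. max (- z u) 0" "\<lambda>u. max (z u) 0"] by simp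
    with nonneg[of "\<lambda>u. max (- z u) 0"] nonneg[of "\<lambda>u. max (z u) 0"] that show ?thesis by simp
  qed
  have "f (\<lambda>u. (- x s) * 1 + x u) = 0" by (rule vanish) simp
  with lin[of "- x s" "\<lambda>_. 1" x] show ?thesis by (simp add: p_def)
qed

text \<open>
  In a conjugate \<open>v\<close> of minimal length, a generator \<open>s\<close> with \<open>s v\<close> shorter than \<open>v\<close> also makes
  \<open>v s\<close> shorter, as \<open>v\<close> is its own inverse, while \<open>s v s\<close> is no shorter than \<open>v\<close>. The resulting
  signs of \<open>x \<mapsto> (v x) s\<close> on two adjacent chambers identify it with a negative multiple of the
  coordinate \<open>s\<close>.
\<close>

lemma involution_negates_root:
  assumes w: "w \<in> carrier G" "w \<otimes> w = \<one>" "w \<noteq> \<one>"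
  shows "\<exists>g \<in> carrier G. \<exists>s \<in> S. \<forall>x. rep (g \<otimes> w \<otimes> inv g) x s = - x s"
proof -
  obtain g where g: "g \<in> carrier G"
    and min: "\<And>h. h \<in> carrier G \<Longrightarrow> len (g \<otimes> w \<otimes> inv g) \<le> len (h \<otimes> w \<otimes> inv h)"
    using ex_has_least_nat[of "\<lambda>g. g \<in> carrier G" \<one> "\<lambda>g. len (g \<otimes> w \<otimes> inv g)"] by auto
  define v where "v = g \<otimes> w \<otimes> inv g"
  have v: "v \<in> carrier G" using g w by (simp add: v_def)
  have "v \<otimes> v = g \<otimes> (w \<otimes> (inv g \<otimes> g) \<otimes> w) \<otimes> inv g"
    unfolding v_def using g w by (simp only: m_assoc m_closed inv_closed)
  also have "\<dots> = \<one>" using g w by simp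
  finally have vv: "v \<otimes> v = \<one>" .
  then have v_inv: "inv v = v" using v by (simp add: inv_equality)
  have "v \<noteq> \<one>"
  proof
    assume "v = \<one>"
    then have "inv g \<otimes> v \<otimes> g = \<one>" using g by simp
    moreover have "inv g \<otimes> v \<otimes> g = (inv g \<otimes> g) \<otimes> w \<otimes> (inv g \<otimes> g)"
      unfolding v_def using g w by (simp only: m_assoc m_closed inv_closed)
    ultimately show False using g w by simp
  qed
  with v obtain s where s: "s \<in> S" "len (s \<otimes> v) < len v" using left_descent_exists by blast
  have vs: "v \<otimes> s \<in> carrier G" using v s by (simp add: S_carrier)
  have "s \<otimes> (v \<otimes> s) = (s \<otimes> g) \<otimes> w \<otimes> inv (s \<otimes> g)"
    unfolding v_def using g w s by (simp add: inv_mult_group S_carrier S_inv m_assoc)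
  then have "len v \<le> len (s \<otimes> (v \<otimes> s))"
    using min[of "s \<otimes> g"] g s by (simp add: v_def S_carrier)
  moreover have "len (v \<otimes> s) = len (s \<otimes> v)" using len_right_eq_left[OF s(1) v] v_inv by simp
  ultimately have up: "len (v \<otimes> s) \<le> len (s \<otimes> (v \<otimes> s))" using s(2) by simp
  have f: "- rep v x s = - rep v (\<lambda>_. 1) s * x s" for x
  proof (rule wall_functional[where f = "\<lambda>x. - rep v x s", OF _ s(1)])
    show "- rep v (\<lambda>u. a * x u + y u) s = a * - rep v x s + - rep v y s" for a x y
      by (simp add: rep_linear)
    show "dominant x \<Longrightarrow> 0 < - rep v x s" for x
      using descent_negative[OF v s] by simp
    show "dominant x \<Longrightarrow> - rep v (sigma s x) s < 0" for x
      using ascent_positive[OF vs s(1) up] rep_mult[OF v S_carrier[OF s(1)]] s(1) by (simp add: rep_gen)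
  qed
  define c where "c = rep v (\<lambda>_. 1) s"
  have c: "rep v x s = c * x s" for x using f[of x] by (simp add: c_def)
  have "c < 0" unfolding c_def using descent_negative[OF v s] dominant_one by blast
  have "c * c = 1"
    using c[of "rep v (\<lambda>_. 1)"] rep_mult[OF v v, of "\<lambda>_. 1"] vv by (simp add: rep_one c_def)
  with \<open>c < 0\<close> have "c = -1" by (metis square_eq_1_iff less_asym zero_less_one)
  with c g s show ?thesis unfolding v_def by auto
qed

section \<open>Half-spaces\<close>

text \<open>
  A root is replaced by the set of chambers on its positive side, a chamber being the group element
  that carries the fundamental chamber to it. Proportional roots then give the same object, so that
  half-spaces can be counted without normalizing roots.
\<close>

definition halfspace :: "'a \<Rightarrow> 'a \<Rightarrow> 'a set" where
  "halfspace g s = {v \<in> carrier G. rep (g \<otimes> v) (\<lambda>_. 1) s > 0}"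

definition sep :: "'a \<Rightarrow> 'a \<Rightarrow> 'a set set" where
  "sep u v = {D. (\<exists>g \<in> carrier G. \<exists>s \<in> S. D = halfspace g s) \<and> u \<in> D \<and> v \<notin> D}"

lemma halfspace_iff_len:
  "g \<in> carrier G \<Longrightarrow> s \<in> S \<Longrightarrow> v \<in> carrier G \<Longrightarrow>
    v \<in> halfspace g s \<longleftrightarrow> len (g \<otimes> v) \<le> len (s \<otimes> (g \<otimes> v))"
  by (simp add: halfspace_def rep_coord_pos_iff dominant_one)

text \<open>
  Two adjacent chambers are separated by only one wall; this is what makes lengths and numbers of
  separating half-spaces agree.
\<close>

lemma crossing_halfspace:
  assumes "g \<in> carrier G" "t \<in> S" "v \<in> carrier G" "s \<in> S"
    and "v \<in> halfspace g t" "v \<otimes> s \<notin> halfspace g t"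
  shows "halfspace g t = halfspace (inv v) s"
proof -
  define f where "f = (\<lambda>x. rep (g \<otimes> v) x t)"
  have gv: "g \<otimes> v \<in> carrier G" "g \<otimes> (v \<otimes> s) \<in> carrier G" "v \<otimes> s \<in> carrier G"
    using assms by (simp_all add: S_carrier)
  have e: "rep (g \<otimes> (v \<otimes> s)) x = rep (g \<otimes> v) (sigma s x)" for x
    using rep_mult[of "g \<otimes> v" s x] assms by (simp add: S_carrier m_assoc rep_gen)
  have f: "f x = f (\<lambda>_. 1) * x s" for x
  proof (rule wall_functional[OF _ assms(4)])
    show "f (\<lambda>u. a * x u + y u) = a * f x + f y" for a x y by (simp add: f_def rep_linear)
    show "dominant x \<Longrightarrow> f x > 0" for x
      using assms by (simp add: f_def halfspace_iff_len rep_coord_pos_iff gv)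
    have "len (t \<otimes> (g \<otimes> (v \<otimes> s))) < len (g \<otimes> (v \<otimes> s))"
      using assms gv by (simp add: halfspace_iff_len)
    then show "dominant x \<Longrightarrow> f (sigma s x) < 0" for x
      using rep_coord_neg_iff[OF gv(2) assms(2), of x] by (simp add: f_def e)
  qed
  have pos: "f (\<lambda>_. 1) > 0" using assms by (simp add: f_def halfspace_def)
  have "rep (g \<otimes> u) (\<lambda>_. 1) t = f (\<lambda>_. 1) * rep (inv v \<otimes> u) (\<lambda>_. 1) s" if "u \<in> carrier G" for u
  proof -
    have "g \<otimes> u = (g \<otimes> v) \<otimes> (inv v \<otimes> u)"
      using that assms by (simp add: m_assoc) (simp add: m_assoc[symmetric])
    then have "rep (g \<otimes> u) (\<lambda>_. 1) t = f (rep (inv v \<otimes> u) (\<lambda>_. 1))"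
      using rep_mult[of "g \<otimes> v" "inv v \<otimes> u"] that assms by (simp add: f_def)
    then show ?thesis using f[of "rep (inv v \<otimes> u) (\<lambda>_. 1)"] by (simp only:)
  qed
  with pos show ?thesis by (auto simp: halfspace_def zero_less_mult_iff)
qed

lemma sep_step:
  assumes "v \<in> carrier G" "s \<in> S"
  shows "sep u (v \<otimes> s) \<subseteq> insert (halfspace (inv v) s) (sep u v)"
proof
  fix D assume "D \<in> sep u (v \<otimes> s)"
  then obtain g t where D: "D = halfspace g t" "g \<in> carrier G" "t \<in> S" "u \<in> D" "v \<otimes> s \<notin> D"
    by (auto simp: sep_def)
  show "D \<in> insert (halfspace (inv v) s) (sep u v)"
  proof (cases "v \<in> D")
    case True
    with crossing_halfspace[of g t v s] D assms show ?thesis by simp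
  next
    case False
    with D show ?thesis by (auto simp: sep_def)
  qed
qed

lemma finite_card_sep_word:
  assumes "u \<in> carrier G" "xs \<in> lists S"
  shows "finite (sep u (u \<otimes> wprod xs)) \<and> card (sep u (u \<otimes> wprod xs)) \<le> length xs"
  using assms(2)
proof (induction xs rule: rev_induct)
  case Nil
  have "sep u u = {}" by (auto simp: sep_def)
  with assms(1) show ?case by simp
next
  case (snoc s xs)
  then have s: "s \<in> S" and xs: "xs \<in> lists S" by auto
  let ?v = "u \<otimes> wprod xs"
  have v: "?v \<in> carrier G" using assms(1) wprod_carrier[OF xs] by simp
  have "u \<otimes> wprod (xs @ [s]) = ?v \<otimes> s"
    using wprod_append[of xs "[s]"] xs s assms(1) wprod_carrier[OF xs] by (simp add: S_carrier m_assoc)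
  then have sub: "sep u (u \<otimes> wprod (xs @ [s])) \<subseteq> insert (halfspace (inv ?v) s) (sep u ?v)"
    using sep_step[OF v s] by simp
  have fin: "finite (insert (halfspace (inv ?v) s) (sep u ?v))" using snoc.IH[OF xs] by simp
  have "card (insert (halfspace (inv ?v) s) (sep u ?v)) \<le> Suc (length xs)"
    using snoc.IH[OF xs] by (simp add: card_insert_if)
  with card_mono[OF fin sub] finite_subset[OF sub fin] show ?case by simp
qed

lemma sep_bound:
  assumes "u \<in> carrier G" "v \<in> carrier G"
  shows "finite (sep u v)" "card (sep u v) \<le> len (inv u \<otimes> v)"
proof -
  obtain xs where "xs \<in> lists S" "length xs = len (inv u \<otimes> v)" "wprod xs = inv u \<otimes> v"
    using reduced_word[of "inv u \<otimes> v"] assms by auto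
  moreover have "u \<otimes> (inv u \<otimes> v) = v" using assms by (simp add: m_assoc[symmetric])
  ultimately show "finite (sep u v)" "card (sep u v) \<le> len (inv u \<otimes> v)"
    using finite_card_sep_word[OF assms(1), of xs] by auto
qed

text \<open>
  If \<open>v = h s\<close> is shorter than \<open>h\<close>, the half-space of the wall between \<open>v\<close> and \<open>h\<close> that contains
  \<open>v\<close> also contains \<open>1\<close>. It separates \<open>1\<close> from \<open>h\<close> but not from \<open>v\<close>. No half-space separating
  \<open>1\<close> from \<open>v\<close> is lost, since it would have to be crossed a second time at this same wall, and the
  half-space of that wall which contains \<open>h\<close> misses \<open>1\<close>.
\<close>

lemma len_le_card_sep:
  assumes "h \<in> carrier G" shows "len h \<le> card (sep \<one> h)"
  using assms
proof (induction "len h" arbitrary: h rule: less_induct)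
  case less
  show ?case
  proof (cases "h = \<one>")
    case True then show ?thesis by (simp add: len_one)
  next
    case False
    have "inv h \<noteq> \<one>" using False less.prems by (metis inv_inv inv_one)
    then obtain s where s: "s \<in> S" "len (s \<otimes> inv h) < len (inv h)"
      using left_descent_exists[of "inv h"] less.prems by auto
    define v where "v = h \<otimes> s"
    have v: "v \<in> carrier G" "v \<otimes> s = h" "inv v = s \<otimes> inv h"
      using less.prems s by (simp_all add: v_def S_carrier S_cancel_right inv_mult_group S_inv)
    have lv: "len v < len h"
      using s len_right_eq_left[OF s(1) less.prems] less.prems by (simp add: v_def len_inv)
    have "len h \<le> Suc (len v)"
      using len_mult_le[of v s] v s len_gen_le[of s] by (simp add: S_carrier)
    let ?D = "halfspace (inv v) s"
    have iv: "inv v \<in> carrier G" using v(1) by (rule inv_closed)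
    have D: "\<one> \<in> ?D" "v \<in> ?D" "h \<notin> ?D"
    proof -
      have "s \<otimes> inv v = inv h" using v(3) s less.prems by (simp add: S_cancel)
      then have "len (inv v) \<le> len (s \<otimes> inv v)" using lv v(1) less.prems by (simp add: len_inv)
      then show "\<one> \<in> ?D" using halfspace_iff_len[OF iv s(1), of \<one>] r_one[OF iv] by simp
      show "v \<in> ?D" using halfspace_iff_len[OF iv s(1) v(1)] l_inv[OF v(1)]
        by (simp only: len_one le0)
      have "inv v \<otimes> h = s" using v(1) s(1) S_carrier
        by (simp add: v(2)[symmetric] m_assoc[symmetric])
      then have "rep (inv v \<otimes> h) (\<lambda>_. 1) s < 0" using s by (simp add: rep_gen sigma_self)
      then show "h \<notin> ?D" by (simp add: halfspace_def)
    qed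
    have "sep \<one> v \<subseteq> sep \<one> h"
    proof
      fix E assume "E \<in> sep \<one> v"
      then obtain g t where E: "E = halfspace g t" "g \<in> carrier G" "t \<in> S" "\<one> \<in> E" "v \<notin> E"
        by (auto simp: sep_def)
      have "h \<notin> E"
      proof
        assume "h \<in> E"
        then have "E = halfspace (inv h) s"
          using crossing_halfspace[of g t h s] E less.prems s by (simp add: v_def)
        with E(4) have "len (inv h) \<le> len (s \<otimes> inv h)"
          using halfspace_iff_len[of "inv h" s \<one>] s less.prems by (simp add: S_carrier)
        with s(2) show False by simp
      qed
      with E show "E \<in> sep \<one> h" by (auto simp: sep_def)
    qed
    moreover have "?D \<in> sep \<one> h" "?D \<notin> sep \<one> v" using D iv s by (auto simp: sep_def)
    ultimately have "sep \<one> v \<subset> sep \<one> h" by blast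
    with sep_bound(1)[OF one_closed less.prems] have "card (sep \<one> v) < card (sep \<one> h)"
      by (rule psubset_card_mono)
    with less.hyps[OF lv v(1)] \<open>len h \<le> Suc (len v)\<close> show ?thesis by simp
  qed
qed

lemma rep_sum:
  assumes "finite A"
  shows "rep g (\<lambda>u. \<Sum>m\<in>A. F m u) = (\<lambda>u. \<Sum>m\<in>A. rep g (F m) u)"
  using assms
proof (induction A rule: finite_induct)
  case empty
  have "rep g (\<lambda>u. (-1) * (\<lambda>_. 0) u + (\<lambda>_. 0) u) = (\<lambda>u. (-1) * rep g (\<lambda>_. 0) u + rep g (\<lambda>_. 0) u)"
    by (rule rep_linear)
  then show ?case by simp
next
  case (insert m A)
  have "rep g (\<lambda>u. 1 * F m u + (\<Sum>m\<in>A. F m u)) = (\<lambda>u. 1 * rep g (F m) u + rep g (\<lambda>u. \<Sum>m\<in>A. F m u) u)"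
    by (rule rep_linear)
  with insert show ?case by simp
qed

text \<open>
  Let \<open>\<phi>\<close> be a root that is positive at \<open>1\<close> and negative at \<open>h\<close>. If \<open>\<phi>\<close> is positive on the
  chambers of all \<open>m \<in> M\<close>, it is positive at their sum \<open>y = h y\<close>, and hence on the chamber of some
  \<open>h m\<close>. So \<open>\<phi>\<close> separates \<open>1\<close> from some \<open>m\<close> or some \<open>h m\<close> from \<open>h\<close>, and the number of such
  roots does not depend on \<open>h\<close>.
\<close>

lemma stabilizer_len_bound:
  assumes M: "finite M" "M \<noteq> {}" "M \<subseteq> carrier G"
    and h: "h \<in> carrier G"
    and fixed: "rep h (\<lambda>u. \<Sum>m\<in>M. rep m (\<lambda>_. 1) u) = (\<lambda>u. \<Sum>m\<in>M. rep m (\<lambda>_. 1) u)"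
  shows "len h \<le> 2 * (\<Sum>m\<in>M. len m)"
proof -
  define y where "y = (\<lambda>u. \<Sum>m\<in>M. rep m (\<lambda>_. 1) u)"
  have rep_y: "rep g y u = (\<Sum>m\<in>M. rep (g \<otimes> m) (\<lambda>_. 1) u)" if "g \<in> carrier G" for g u
    unfolding y_def rep_sum[OF M(1)]
    using that M(3) by (intro sum.cong) (auto simp: rep_mult)
  have "sep \<one> h \<subseteq> (\<Union>m\<in>M. sep \<one> m) \<union> (\<Union>m\<in>M. sep (h \<otimes> m) h)"
  proof
    fix D assume "D \<in> sep \<one> h"
    then obtain g s where D: "D = halfspace g s" "g \<in> carrier G" "s \<in> S" "\<one> \<in> D" "h \<notin> D"
      by (auto simp: sep_def)
    show "D \<in> (\<Union>m\<in>M. sep \<one> m) \<union> (\<Union>m\<in>M. sep (h \<otimes> m) h)"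
    proof (cases "M \<subseteq> D")
      case False
      with D show ?thesis by (auto simp: sep_def)
    next
      case True
      have "0 < rep g y s" unfolding rep_y[OF D(2)]
        using True M D by (intro sum_pos) (auto simp: halfspace_def)
      also have "rep g y s = rep (g \<otimes> h) y s"
        using rep_mult[OF D(2) h] fixed by (simp add: y_def)
      also have "\<dots> = (\<Sum>m\<in>M. rep (g \<otimes> h \<otimes> m) (\<lambda>_. 1) s)"
        using rep_y D h by simp
      finally obtain m where m: "m \<in> M" "rep (g \<otimes> h \<otimes> m) (\<lambda>_. 1) s > 0"
        by (meson not_le sum_nonpos)
      then have "h \<otimes> m \<in> D" using D h M by (auto simp: halfspace_def m_assoc)
      with D m show ?thesis by (auto simp: sep_def)
    qed
  qed
  moreover have fin: "finite (\<Union>m\<in>M. sep \<one> m)" "finite (\<Union>m\<in>M. sep (h \<otimes> m) h)"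
    using M h by (auto intro!: sep_bound(1))
  ultimately have "card (sep \<one> h) \<le> card ((\<Union>m\<in>M. sep \<one> m) \<union> (\<Union>m\<in>M. sep (h \<otimes> m) h))"
    by (intro card_mono) auto
  also have "\<dots> \<le> card (\<Union>m\<in>M. sep \<one> m) + card (\<Union>m\<in>M. sep (h \<otimes> m) h)"
    by (rule card_Un_le)
  also have "card (\<Union>m\<in>M. sep \<one> m) \<le> (\<Sum>m\<in>M. card (sep \<one> m))"
    by (rule card_UN_le[OF M(1)])
  also have "\<dots> \<le> (\<Sum>m\<in>M. len m)"
  proof (rule sum_mono)
    fix m assume "m \<in> M"
    with M sep_bound(2)[of \<one> m] show "card (sep \<one> m) \<le> len m" by auto
  qed
  also have "card (\<Union>m\<in>M. sep (h \<otimes> m) h) \<le> (\<Sum>m\<in>M. card (sep (h \<otimes> m) h))"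
    by (rule card_UN_le[OF M(1)])
  also have "\<dots> \<le> (\<Sum>m\<in>M. len m)"
  proof (rule sum_mono)
    fix m assume "m \<in> M"
    then have m: "m \<in> carrier G" using M by auto
    have "inv (h \<otimes> m) \<otimes> h = inv m" using m h by (simp add: inv_mult_group m_assoc)
    with sep_bound(2)[of "h \<otimes> m" h] m h show "card (sep (h \<otimes> m) h) \<le> len m"
      by (simp add: len_inv)
  qed
  finally show ?thesis using len_le_card_sep[OF h] by simp
qed

section \<open>Finite subgroups\<close>

text \<open>
  The vector that is \<open>1\<close> at \<open>s\<close> and \<open>0\<close> elsewhere is fixed by all other generators but moved by
  \<open>s\<close> itself, so no generator is redundant.
\<close>

lemma generating_subset_eq:
  assumes "T \<subseteq> S" "\<And>s. s \<in> S \<Longrightarrow> \<exists>xs \<in> lists T. wprod xs = s"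
  shows "S = T"
proof (rule ccontr)
  assume "S \<noteq> T"
  then obtain s where s: "s \<in> S" "s \<notin> T" using assms by blast
  obtain xs where xs: "xs \<in> lists T" "wprod xs = s" using assms s by blast
  define e where "e = (\<lambda>u. if u = s then 1 else 0 :: real)"
  have "act xs e = e" using xs(1)
  proof (induction xs)
    case (Cons t xs)
    then have "e t = 0" using s by (auto simp: e_def)
    with Cons show ?case by (simp add: sigma_fixes)
  qed simp
  moreover have "xs \<in> lists S" using xs(1) assms(1) by auto
  then have "act xs e = sigma s e"
    using rep_wprod[of xs] rep_gen[OF s(1)] xs(2) by simp
  ultimately have "sigma s e s = e s" by simp
  with s show False by (simp add: sigma_self e_def)
qed

text \<open>
  Finite rank is a property of the group: words for the elements of one finite generating set use only
  finitely many letters of any other Coxeter generating set.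
\<close>

lemma finite_generators:
  assumes F: "finite F" "generate G F = carrier G"
  shows "finite S"
proof -
  have "F \<subseteq> carrier G" using F(2) generate.incl by fastforce
  then have "\<forall>f \<in> F. \<exists>xs. xs \<in> lists S \<and> wprod xs = f" using word_exists by blast
  then obtain W where W: "\<And>f. f \<in> F \<Longrightarrow> W f \<in> lists S \<and> wprod (W f) = f" by metis
  define T where "T = (\<Union>f\<in>F. set (W f))"
  have T: "finite T" "T \<subseteq> S" using F W by (auto simp: T_def)
  have TS: "xs \<in> lists T \<Longrightarrow> xs \<in> lists S" for xs using T(2) by auto
  have "\<exists>xs \<in> lists T. wprod xs = g" if "g \<in> generate G F" for g
    using that
  proof (induction rule: generate.induct)
    case one show ?case by (rule bexI[of _ "[]"]) auto
  next
    case (incl f) then show ?case using W by (intro bexI[of _ "W f"]) (auto simp: T_def)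
  next
    case (inv f)
    then have "wprod (rev (W f)) = inv f" using wprod_rev[of "W f"] W[of f] by simp
    with inv show ?case by (intro bexI[of _ "rev (W f)"]) (auto simp: T_def)
  next
    case (eng g h)
    then obtain xs ys where "xs \<in> lists T" "wprod xs = g" "ys \<in> lists T" "wprod ys = h" by blast
    then show ?case using TS wprod_append[of xs ys] by (intro bexI[of _ "xs @ ys"]) auto
  qed
  then have "S = T" using T(2) F(2) S_carrier by (intro generating_subset_eq) auto
  with T(1) show ?thesis by simp
qed

lemma finite_bounded_len:
  assumes "finite S" shows "finite {g \<in> carrier G. len g \<le> n}"
proof (rule finite_subset)
  show "{g \<in> carrier G. len g \<le> n} \<subseteq> wprod ` {xs. set xs \<subseteq> S \<and> length xs \<le> n}"
  proof
    fix g assume "g \<in> {g \<in> carrier G. len g \<le> n}"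
    then have g: "g \<in> carrier G" "len g \<le> n" by auto
    obtain xs where "xs \<in> lists S" "length xs = len g" "wprod xs = g" using reduced_word[OF g(1)] .
    with g(2) show "g \<in> wprod ` {xs. set xs \<subseteq> S \<and> length xs \<le> n}" by (intro image_eqI[of _ _ xs]) auto
  qed
  show "finite (wprod ` {xs. set xs \<subseteq> S \<and> length xs \<le> n})"
    using finite_lists_length_le[OF assms] by simp
qed

text \<open>
  The sum \<open>y\<close> of the \<open>M\<close>-orbit has a finite stabilizer containing \<open>M\<close>, hence equal to \<open>M\<close>. A root
  negated by \<open>w\<close> takes the same value at \<open>y = w y\<close> up to sign, so it vanishes at \<open>y\<close> and its
  reflection fixes \<open>y\<close>.
\<close>

lemma reflection_in_maximal_finite:
  assumes fin: "finite S"
    and M: "maximal_finite_subgroup G M" "w \<in> M"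
    and g: "g \<in> carrier G" and s: "s \<in> S"
    and neg: "\<And>x. rep (g \<otimes> w \<otimes> inv g) x s = - x s"
  shows "inv g \<otimes> s \<otimes> g \<in> M"
proof -
  have sub: "subgroup M G" and finM: "finite M" using M by (auto simp: maximal_finite_subgroup_def)
  note Mc = subgroup.mem_carrier[OF sub]
  define y where "y = (\<lambda>u. \<Sum>m\<in>M. rep m (\<lambda>_. 1) u)"
  have M_fix: "rep m y = y" if m: "m \<in> M" for m
  proof
    fix u
    have "rep m y u = (\<Sum>n\<in>M. rep (m \<otimes> n) (\<lambda>_. 1) u)"
      unfolding y_def rep_sum[OF finM] using m Mc by (intro sum.cong) (auto simp: rep_mult)
    also have "\<dots> = (\<Sum>n\<in>M. rep n (\<lambda>_. 1) u)"
    proof (rule sum.reindex_bij_witness[of _ "\<lambda>n. inv m \<otimes> n" "\<lambda>n. m \<otimes> n"])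
      fix n assume n: "n \<in> M"
      note c = Mc[OF m] Mc[OF n]
      show "inv m \<otimes> (m \<otimes> n) = n" "m \<otimes> (inv m \<otimes> n) = n"
        using c by (simp_all add: m_assoc[symmetric])
      show "m \<otimes> n \<in> M" "inv m \<otimes> n \<in> M"
        using m n sub by (simp_all add: subgroup.m_closed subgroup.m_inv_closed)
    qed simp
    finally show "rep m y u = y u" by (simp add: y_def)
  qed
  define H where "H = {h \<in> carrier G. rep h y = y}"
  have H: "subgroup H G"
  proof (rule subgroupI)
    show "H \<subseteq> carrier G" by (auto simp: H_def)
    show "H \<noteq> {}" using rep_one[of y] by (auto simp: H_def)
    show "inv a \<in> H" if "a \<in> H" for a
    proof -
      have a: "a \<in> carrier G" "rep a y = y" using that by (auto simp: H_def)
      have "rep (inv a) y = rep (inv a) (rep a y)" using a by simp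
      also have "\<dots> = rep (inv a \<otimes> a) y" using rep_mult[of "inv a" a y] a by simp
      also have "\<dots> = y" using a by (simp add: rep_one)
      finally show ?thesis using a by (simp add: H_def)
    qed
    show "a \<otimes> b \<in> H" if "a \<in> H" "b \<in> H" for a b
      using that by (simp add: H_def rep_mult)
  qed
  have "M \<noteq> {}" using M by auto
  have "H \<subseteq> {h \<in> carrier G. len h \<le> 2 * (\<Sum>m\<in>M. len m)}"
    using stabilizer_len_bound[OF finM \<open>M \<noteq> {}\<close>] Mc by (auto simp: H_def y_def)
  then have "finite H" using finite_bounded_len[OF fin] finite_subset by blast
  moreover have "M \<subseteq> H" using M_fix Mc by (auto simp: H_def)
  ultimately have "H = M" using M(1) H by (auto simp: maximal_finite_subgroup_def)
  have w: "w \<in> carrier G" "rep w y = y" using M Mc M_fix by auto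
  have "rep (g \<otimes> w \<otimes> inv g) (rep g y) = rep (g \<otimes> w \<otimes> inv g \<otimes> g) y"
    using g w rep_mult[of "g \<otimes> w \<otimes> inv g" g y] by simp
  also have "g \<otimes> w \<otimes> inv g \<otimes> g = g \<otimes> w" using g w by (simp add: m_assoc)
  also have "rep (g \<otimes> w) y = rep g y" using rep_mult[OF g w(1), of y] w by simp
  finally have "rep g y s = 0" using neg[of "rep g y"] by simp
  then have "rep s (rep g y) = rep g y" using s by (simp add: rep_gen sigma_fixes)
  then have "rep (inv g \<otimes> s \<otimes> g) y = rep (inv g) (rep g y)"
    using g s by (simp add: rep_mult S_carrier)
  also have "\<dots> = y" using rep_mult[of "inv g" g y] g by (simp add: rep_one)
  finally have "inv g \<otimes> s \<otimes> g \<in> H" using g s by (simp add: H_def S_carrier)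
  with \<open>H = M\<close> show ?thesis by simp
qed

end

lemma (in group) generate_involution:
  assumes "w \<in> carrier G" "w \<otimes> w = \<one>"
  shows "generate G {w} \<subseteq> {\<one>, w}"
proof (rule generate_subgroup_incl)
  have "inv w = w" using assms by (simp add: inv_equality)
  with assms show "subgroup {\<one>, w} G" by (intro subgroupI) auto
qed simp

theorem corollary24:
  fixes W :: "('a, 'b) monoid_scheme" and w :: 'a and S :: "'a set"
  assumes "coxeter_group_of_finite_rank W"
    and "involution W w"
    and "finite_continuation W w = generate W {w}"
    and "coxeter_system W S"
  shows "w \<in> conjugates W S"
proof -
  interpret coxeter W S using assms(4) by unfold_locales
  obtain F where "finite F" "coxeter_system W F"
    using assms(1) by (auto simp: coxeter_group_of_finite_rank_def)
  then have fin: "finite S"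
    using finite_generators by (auto simp: coxeter_system_def has_presentation_def)
  have w: "w \<in> carrier W" and ord_w: "ord w = 2"
    using assms(2) by (auto simp: involution_def)
  have ww: "w \<otimes>\<^bsub>W\<^esub> w = \<one>\<^bsub>W\<^esub>"
    using pow_ord_eq_1[OF w] ord_w w by (simp add: numeral_2_eq_2)
  have w1: "w \<noteq> \<one>\<^bsub>W\<^esub>" using ord_w by fastforce
  obtain g s where g: "g \<in> carrier W" and s: "s \<in> S"
    and neg: "\<And>x. rep (g \<otimes>\<^bsub>W\<^esub> w \<otimes>\<^bsub>W\<^esub> inv\<^bsub>W\<^esub> g) x s = - x s"
    using involution_negates_root[OF w ww w1] by blast
  define t where "t = inv\<^bsub>W\<^esub> g \<otimes>\<^bsub>W\<^esub> s \<otimes>\<^bsub>W\<^esub> g"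
  have "t \<in> finite_continuation W w"
    using reflection_in_maximal_finite[OF fin _ _ g s neg] g s
    by (auto simp: finite_continuation_def t_def S_carrier)
  then have "t \<in> {\<one>\<^bsub>W\<^esub>, w}" using assms(3) generate_involution[OF w ww] by auto
  moreover have "t \<noteq> \<one>\<^bsub>W\<^esub>"
  proof
    assume "t = \<one>\<^bsub>W\<^esub>"
    then have "g \<otimes>\<^bsub>W\<^esub> t \<otimes>\<^bsub>W\<^esub> inv\<^bsub>W\<^esub> g = \<one>\<^bsub>W\<^esub>" using g by simp
    moreover have "g \<otimes>\<^bsub>W\<^esub> t \<otimes>\<^bsub>W\<^esub> inv\<^bsub>W\<^esub> g
        = (g \<otimes>\<^bsub>W\<^esub> inv\<^bsub>W\<^esub> g) \<otimes>\<^bsub>W\<^esub> s \<otimes>\<^bsub>W\<^esub> (g \<otimes>\<^bsub>W\<^esub> inv\<^bsub>W\<^esub> g)"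
      unfolding t_def using g S_carrier[OF s] by (simp only: m_assoc m_closed inv_closed)
    ultimately show False using g s S_not_one[OF s] by (simp add: S_carrier)
  qed
  ultimately have "w = inv\<^bsub>W\<^esub> g \<otimes>\<^bsub>W\<^esub> s \<otimes>\<^bsub>W\<^esub> g" by (simp add: t_def)
  with g s show ?thesis by (auto simp: conjugates_def)
qed

end
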